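(* Let $G=(V(G),A(G))$ be a weakly connected digraph with $\delta^+(G)\geq 2$ and $\delta^-(G)\geq 1$. For every integer $n\geq 1$, $Z(L^n(G))=|V(L^n(G))|-|V(L^{n-1}(G))|$.
   Context: A digraph $G$ has a finite non-empty vertex set $V(G)$ and a set $A(G)\subseteq V(G)\times V(G)$ of arcs; loops $(u,u)$ are allowed. $N^+_G(v)=\{u:(v,u)\in A(G)\}$, $N^-_G(v)=\{w:(w,v)\in A(G)\}$, $d^\pm_G(v)=|N^\pm_G(v)|$; $\delta^\pm(G)$ is the minimum of $d^\pm_G(v)$ over $v\in V(G)$. $G$ is weakly connected if its underlying undirected graph is connected. Line digraph: $L(G)$ has vertex set $\{uv:(u,v)\in A(G)\}$, with an arc from $uv$ to $xy$ exactly when $v=x$. $L^0(G)=G$ and $L^r(G)=L(L^{r-1}(G))$ for $r\geq 1$. Zero forcing in a digraph $H$: for non-empty $S\subseteq V(H)$ put $B^0(S)=S$ and, for $i\ge 0$: if $H$ has no loops, $B^{i+1}(S)=B^i(S)\cup\{v\in V(H)\setminus B^i(S):\exists u\in B^i(S),\ N^+_H(u)\setminus B^i(S)=\{v\}\}$; if $H$ has at least one loop, $B^{i+1}(S)=B^i(S)\cup\{v\in V(H)\setminus B^i(S):\exists u\in V(H),\ N^+_H(u)\setminus B^i(S)=\{v\}\}$. $S$ is a zero forcing set if $B^m(S)=V(H)$ for some $m\ge 0$. $Z(H)$ is the minimum cardinality of a zero forcing set of $H$. *)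

theory Defs
  imports "Graph_Theory.Graph_Theory"
begin

text \<open>
  Digraphs are values of the library type \<open>'a pair_pre_digraph\<close>: the arcs are ordered pairs of
  vertices, so there are no parallel arcs and loops are allowed.
\<close>

definition out_nbrs :: "'a pair_pre_digraph \<Rightarrow> 'a \<Rightarrow> 'a set" where
  "out_nbrs H v = {u. (v, u) \<in> parcs H}"

definition in_nbrs :: "'a pair_pre_digraph \<Rightarrow> 'a \<Rightarrow> 'a set" where
  "in_nbrs H v = {w. (w, v) \<in> parcs H}"

definition min_out_degree :: "'a pair_pre_digraph \<Rightarrow> nat" where
  "min_out_degree H = Min ((\<lambda>v. out_degree (with_proj H) v) ` pverts H)"

definition min_in_degree :: "'a pair_pre_digraph \<Rightarrow> nat" where
  "min_in_degree H = Min ((\<lambda>v. in_degree (with_proj H) v) ` pverts H)"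

text \<open>The library counts incident arcs; here this is the same as counting neighbours.\<close>

lemma out_degree_eq_card_out_nbrs: "out_degree (with_proj H) v = card (out_nbrs H v)"
proof -
  have "out_arcs (with_proj H) v = Pair v ` out_nbrs H v"
    by (auto simp: out_nbrs_def out_arcs_def)
  then show ?thesis
    by (simp add: out_degree_def card_image inj_on_def)
qed

lemma in_degree_eq_card_in_nbrs: "in_degree (with_proj H) v = card (in_nbrs H v)"
proof -
  have "in_arcs (with_proj H) v = (\<lambda>w. (w, v)) ` in_nbrs H v"
    by (auto simp: in_nbrs_def in_arcs_def)
  then show ?thesis
    by (simp add: in_degree_def card_image inj_on_def)
qed

text \<open>
  The vertices of a line digraph are the arcs of the given digraph. To iterate the construction
  inside one type, an arc \<open>(u, v)\<close> is recorded as the vertex \<open>Arc u v\<close>, and the vertices \<open>v\<close> of the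
  initial digraph as \<open>Base v\<close>. Both constructors are injective, so this is only a renaming.
\<close>

datatype 'a lvertex = Base 'a | Arc "'a lvertex" "'a lvertex"

definition base_copy :: "'a pair_pre_digraph \<Rightarrow> 'a lvertex pair_pre_digraph" where
  "base_copy G = \<lparr> pverts = Base ` pverts G,
                   parcs = {(Base u, Base v) | u v. (u, v) \<in> parcs G} \<rparr>"

definition line_digraph :: "'a lvertex pair_pre_digraph \<Rightarrow> 'a lvertex pair_pre_digraph" where
  "line_digraph H =
     \<lparr> pverts = {Arc u v | u v. (u, v) \<in> parcs H},
       parcs = {(Arc u v, Arc x y) | u v x y. (u, v) \<in> parcs H \<and> (x, y) \<in> parcs H \<and> v = x} \<rparr>"

definition iter_line_digraph :: "nat \<Rightarrow> 'a pair_pre_digraph \<Rightarrow> 'a lvertex pair_pre_digraph" where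
  "iter_line_digraph r G = (line_digraph ^^ r) (base_copy G)"

lemma base_copy_iso:
  assumes "pair_wf_digraph G"
  shows "digraph_iso (with_proj G) (with_proj (base_copy G))"
proof -
  interpret pair_wf_digraph G by fact
  let ?f = "\<lparr> iso_verts = Base, iso_arcs = map_prod Base Base, iso_head = snd, iso_tail = fst \<rparr>"
  have "digraph_isomorphism ?f"
    unfolding digraph_isomorphism_def
    by (auto simp: inj_on_def intro: wf_digraph)
  moreover have "with_proj (base_copy G) = app_iso ?f (with_proj G)"
    by (auto simp: with_proj_def app_iso_def base_copy_def map_prod_def image_iff split: prod.splits)
  ultimately show ?thesis
    unfolding digraph_iso_def by blast
qed

definition has_loop :: "'a pair_pre_digraph \<Rightarrow> bool" where
  "has_loop H \<longleftrightarrow> (\<exists>u. (u, u) \<in> parcs H)"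

text \<open>
  In a digraph with at least one loop a vertex may force whether or not it is itself in the
  current set.
\<close>

definition force_step :: "'a pair_pre_digraph \<Rightarrow> 'a set \<Rightarrow> 'a set" where
  "force_step H B =
     (if has_loop H
      then B \<union> {v \<in> pverts H - B. \<exists>u \<in> pverts H. out_nbrs H u - B = {v}}
      else B \<union> {v \<in> pverts H - B. \<exists>u \<in> B. out_nbrs H u - B = {v}})"

primrec forced :: "'a pair_pre_digraph \<Rightarrow> nat \<Rightarrow> 'a set \<Rightarrow> 'a set" where
  "forced H 0 S = S"
| "forced H (Suc i) S = force_step H (forced H i S)"

definition zero_forcing_set :: "'a pair_pre_digraph \<Rightarrow> 'a set \<Rightarrow> bool" where
  "zero_forcing_set H S \<longleftrightarrow>
     S \<noteq> {} \<and> S \<subseteq> pverts H \<and> (\<exists>m. forced H m S = pverts H)"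

definition zero_forcing_number :: "'a pair_pre_digraph \<Rightarrow> nat" where
  "zero_forcing_number H = Min (card ` {S. zero_forcing_set H S})"

end

theory Submission
  imports Defs
begin

text \<open>
  Write \<open>L\<close> for the line digraph of \<open>H\<close>. The out-neighbourhood in \<open>L\<close> of an arc with head \<open>v\<close> is
  the set \<open>O v\<close> of all arcs with tail \<open>v\<close>. As every vertex of \<open>H\<close> has an in-neighbour and an
  out-neighbour, the sets \<open>O v\<close> partition the vertices of \<open>L\<close> into as many classes as \<open>H\<close> has
  vertices, and each force happens inside one class.

  If a set misses two members of a class, neither can ever be the unique missing
  out-neighbour of anything, so both stay missing (\<open>twins_never_forced\<close>). Hence a zero forcing
  set misses at most one arc of each class, which is the lower bound.

  For the upper bound one omits exactly one arc \<open>(v, f v)\<close> from each class. In the presence of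
  loops every choice of \<open>f\<close> succeeds at once; without loops a class can be completed only by an arc
  into \<open>v\<close> that is already in the set, and \<open>f\<close> must be chosen with care. If the process stalls, let
  \<open>U\<close> be the set of tails of missing arcs. Every arc into a member of \<open>U\<close> is missing, so \<open>U\<close> contains
  the in-neighbours of its members, and \<open>f w = v\<close> whenever \<open>(w, v)\<close> is an arc with \<open>v\<close> in \<open>U\<close>. Thus
  \<open>f\<close> would run around a directed cycle that no arc enters. This is avoided by letting \<open>f v\<close>
  be an out-neighbour from which as few vertices as possible can be reached: since \<open>v\<close> has a second
  out-neighbour, such an \<open>f\<close> leaves the cycle (\<open>no_stalled_set\<close>). The same set works for both forcing
  rules.

  The degree conditions pass from a digraph to its line digraph, so the equality holds at every
  iteration.
\<close>

section \<open>Digraphs with branching and the line construction\<close>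

text \<open>
  Two distinct out-neighbours are named instead of bounding a degree, because this is the form in
  which the condition is used, and it transfers to the line digraph without counting.
\<close>

locale branching_digraph = pair_fin_digraph H for H :: "'a pair_pre_digraph" +
  assumes verts_nonempty: "pverts H \<noteq> {}"
    and two_out_nbrs: "v \<in> pverts H \<Longrightarrow> \<exists>x y. x \<noteq> y \<and> (v, x) \<in> parcs H \<and> (v, y) \<in> parcs H"
    and some_in_nbr: "v \<in> pverts H \<Longrightarrow> \<exists>w. (w, v) \<in> parcs H"

lemma branching_digraphI_degrees:
  assumes "pair_fin_digraph G" "pverts G \<noteq> {}" "min_out_degree G \<ge> 2" "min_in_degree G \<ge> 1"
  shows "branching_digraph G"
proof -
  interpret pair_fin_digraph G by fact
  have out2: "card (out_nbrs G v) \<ge> 2" and in1: "card (in_nbrs G v) \<ge> 1" if "v \<in> pverts G" for v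
    using assms(3,4) that
    by (auto simp: min_out_degree_def min_in_degree_def out_degree_eq_card_out_nbrs
        in_degree_eq_card_in_nbrs dest: order_trans[OF _ Min_le])
  show ?thesis
  proof
    show "pverts G \<noteq> {}" by fact
    fix v assume v: "v \<in> pverts G"
    from out2[OF v] obtain x y where "x \<in> out_nbrs G v" "y \<in> out_nbrs G v" "x \<noteq> y"
      by (metis card_le_Suc0_iff_eq card.infinite not_less_eq_eq numeral_2_eq_2 zero_le)
    then show "\<exists>x y. x \<noteq> y \<and> (v, x) \<in> parcs G \<and> (v, y) \<in> parcs G"
      by (auto simp: out_nbrs_def)
    from in1[OF v] have "in_nbrs G v \<noteq> {}" by auto
    then show "\<exists>w. (w, v) \<in> parcs G" by (auto simp: in_nbrs_def)
  qed
qed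

lemma branching_base_copy:
  assumes "branching_digraph G"
  shows "branching_digraph (base_copy G)"
proof -
  interpret branching_digraph G by fact
  have "parcs (base_copy G) = map_prod Base Base ` parcs G"
    by (auto simp: base_copy_def)
  then have "finite (parcs (base_copy G))" by simp
  then show ?thesis
  proof unfold_locales
    show "pverts (base_copy G) \<noteq> {}"
      using verts_nonempty by (simp add: base_copy_def)
    fix v assume "v \<in> pverts (base_copy G)"
    then obtain v' where v': "v = Base v'" "v' \<in> pverts G"
      by (auto simp: base_copy_def)
    obtain x y where "x \<noteq> y" "(v', x) \<in> parcs G" "(v', y) \<in> parcs G"
      using two_out_nbrs[OF v'(2)] by blast
    then have "Base x \<noteq> Base y \<and> (v, Base x) \<in> parcs (base_copy G) \<and>
        (v, Base y) \<in> parcs (base_copy G)"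
      by (simp add: base_copy_def v')
    then show "\<exists>x y. x \<noteq> y \<and> (v, x) \<in> parcs (base_copy G) \<and> (v, y) \<in> parcs (base_copy G)"
      by blast
    obtain w where "(w, v') \<in> parcs G"
      using some_in_nbr[OF v'(2)] by blast
    then have "(Base w, v) \<in> parcs (base_copy G)"
      by (simp add: base_copy_def v')
    then show "\<exists>w. (w, v) \<in> parcs (base_copy G)" ..
  qed (auto simp: base_copy_def dest: in_arcsD1 in_arcsD2)
qed

lemma pverts_line_digraph_image: "pverts (line_digraph H) = case_prod Arc ` parcs H"
  by (auto simp: line_digraph_def)

lemma Arc_in_line_digraph_iff [simp]: "Arc u v \<in> pverts (line_digraph H) \<longleftrightarrow> (u, v) \<in> parcs H"
  by (simp add: line_digraph_def)

lemma out_nbrs_line_digraph_Arc: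
  "(u, v) \<in> parcs H \<Longrightarrow> out_nbrs (line_digraph H) (Arc u v) = {Arc v x | x. (v, x) \<in> parcs H}"
  by (auto simp: out_nbrs_def line_digraph_def)

lemma branching_line_digraph:
  assumes "branching_digraph H"
  shows "branching_digraph (line_digraph H)"
proof -
  interpret branching_digraph H by fact
  have fin: "finite (pverts (line_digraph H))"
    by (simp add: pverts_line_digraph_image)
  have sub: "parcs (line_digraph H) \<subseteq> pverts (line_digraph H) \<times> pverts (line_digraph H)"
    by (auto simp: line_digraph_def)
  show ?thesis
  proof
    show "finite (parcs (line_digraph H))"
      using finite_subset[OF sub] fin by blast
    show "pverts (line_digraph H) \<noteq> {}"
      using verts_nonempty two_out_nbrs Arc_in_line_digraph_iff[of _ _ H] by (metis ex_in_conv)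
    fix a assume "a \<in> pverts (line_digraph H)"
    then obtain u v where a: "a = Arc u v" and uv: "(u, v) \<in> parcs H"
      by (auto simp: line_digraph_def)
    from uv have "u \<in> pverts H" "v \<in> pverts H" by (auto dest: in_arcsD1 in_arcsD2)
    then obtain x y w where "x \<noteq> y" "(v, x) \<in> parcs H" "(v, y) \<in> parcs H" "(w, u) \<in> parcs H"
      using two_out_nbrs some_in_nbr by metis
    with uv have "Arc v x \<noteq> Arc v y" "(a, Arc v x) \<in> parcs (line_digraph H)"
      "(a, Arc v y) \<in> parcs (line_digraph H)" "(Arc w u, a) \<in> parcs (line_digraph H)"
      by (simp_all add: line_digraph_def a)
    then show "\<exists>x y. x \<noteq> y \<and> (a, x) \<in> parcs (line_digraph H) \<and> (a, y) \<in> parcs (line_digraph H)"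
      and "\<exists>w. (w, a) \<in> parcs (line_digraph H)"
      by blast+
  qed (use fin sub in auto)
qed

lemma branching_iter_line_digraph:
  assumes "branching_digraph G"
  shows "branching_digraph (iter_line_digraph r G)"
  by (induction r) (simp_all add: iter_line_digraph_def branching_base_copy[OF assms] branching_line_digraph)

section \<open>The forcing process\<close>

text \<open>
  The two properties of a step on which everything rests, common to both rules: membership of the
  forcing vertex in the current set suffices for a force, and every force has a witness somewhere.
\<close>

lemma force_stepI:
  assumes "u \<in> B" "B \<subseteq> pverts H" "v \<in> pverts H" "out_nbrs H u - B = {v}"
  shows "v \<in> force_step H B"
  using assms by (auto simp: force_step_def)

lemma force_stepE:
  assumes "v \<in> force_step H B" "v \<notin> B"
  obtains u where "out_nbrs H u - B = {v}"
  using assms by (auto simp: force_step_def split: if_splits)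

lemma subset_force_step: "B \<subseteq> force_step H B"
  by (auto simp: force_step_def)

lemma force_step_subset_pverts: "B \<subseteq> pverts H \<Longrightarrow> force_step H B \<subseteq> pverts H"
  by (auto simp: force_step_def)

lemma forced_Suc_shift: "forced H (Suc m) S = forced H m (force_step H S)"
  by (induction m) simp_all

lemma forced_reaches_pverts:
  assumes "finite (pverts H)" "S \<subseteq> pverts H"
    and "\<And>T. S \<subseteq> T \<Longrightarrow> T \<subset> pverts H \<Longrightarrow> force_step H T \<noteq> T"
  shows "\<exists>m. forced H m S = pverts H"
  using assms(2,3)
proof (induction "card (pverts H - S)" arbitrary: S rule: less_induct)
  case less
  show ?case
  proof (cases "S = pverts H")
    case True
    then have "forced H 0 S = pverts H" by simp
    then show ?thesis ..
  next
    case False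
    let ?S = "force_step H S"
    have "S \<subset> ?S"
      using False less.prems subset_force_step[of S H] by blast
    moreover have "?S \<subseteq> pverts H"
      using less.prems(1) by (rule force_step_subset_pverts)
    ultimately have "card (pverts H - ?S) < card (pverts H - S)"
      using assms(1) by (intro psubset_card_mono) auto
    then have "\<exists>m. forced H m ?S = pverts H"
      using \<open>S \<subset> ?S\<close> \<open>?S \<subseteq> pverts H\<close> less.prems(2) by (intro less.hyps) auto
    then show ?thesis
      using forced_Suc_shift by metis
  qed
qed

section \<open>At most one arc per tail can be omitted\<close>

text \<open>
  An out-neighbourhood that contains one of two such vertices contains the other as well, so it
  never has just one missing member.
\<close>

lemma twins_never_forced:
  assumes twins: "\<And>u. a \<in> out_nbrs H u \<longleftrightarrow> b \<in> out_nbrs H u"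
    and "a \<noteq> b" "a \<notin> S" "b \<notin> S"
  shows "a \<notin> forced H m S \<and> b \<notin> forced H m S"
proof (induction m)
  case 0
  show ?case using assms by simp
next
  case (Suc m)
  let ?B = "forced H m S"
  have both: "a \<in> out_nbrs H u - ?B \<longleftrightarrow> b \<in> out_nbrs H u - ?B" for u
    using twins Suc by blast
  have "out_nbrs H u - ?B \<noteq> {a} \<and> out_nbrs H u - ?B \<noteq> {b}" for u
    using both[of u] \<open>a \<noteq> b\<close> by (metis singleton_iff)
  then show ?case
    using Suc by (metis force_stepE forced.simps(2))
qed

lemma same_tail_twins:
  assumes "(v, x) \<in> parcs H" "(v, y) \<in> parcs H"
  shows "Arc v x \<in> out_nbrs (line_digraph H) u \<longleftrightarrow> Arc v y \<in> out_nbrs (line_digraph H) u"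
  using assms by (auto simp: out_nbrs_def line_digraph_def)

lemma card_zero_forcing_set_ge:
  assumes "finite (pverts H)" "finite (parcs H)" "parcs H \<subseteq> pverts H \<times> pverts H"
    and "zero_forcing_set (line_digraph H) S"
  shows "card (pverts (line_digraph H)) \<le> card S + card (pverts H)"
proof -
  let ?V = "pverts (line_digraph H)" and ?tail = "\<lambda>a. case a of Arc u v \<Rightarrow> u | Base b \<Rightarrow> Base b"
  obtain m where SV: "S \<subseteq> ?V" and m: "forced (line_digraph H) m S = ?V"
    using assms(4) by (auto simp: zero_forcing_set_def)
  have fin: "finite ?V"
    using assms(2) by (simp add: pverts_line_digraph_image)
  have "inj_on ?tail (?V - S)"
  proof (rule inj_onI)
    fix a b assume "a \<in> ?V - S" "b \<in> ?V - S" "?tail a = ?tail b"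
    then obtain v x y where "a = Arc v x" "b = Arc v y" "(v, x) \<in> parcs H" "(v, y) \<in> parcs H"
      "Arc v x \<notin> S" "Arc v y \<notin> S"
      by (auto simp: pverts_line_digraph_image)
    then show "a = b"
      using twins_never_forced[OF same_tail_twins, of v x H y S m] m by auto
  qed
  moreover have "?tail ` (?V - S) \<subseteq> pverts H"
    using assms(3) by (auto simp: pverts_line_digraph_image)
  ultimately have "card (?V - S) \<le> card (pverts H)"
    using assms(1) by (intro card_inj_on_le)
  then show ?thesis
    using card_Diff_subset[of S ?V] finite_subset[OF SV fin] SV by simp
qed

section \<open>Omitting one arc per tail\<close>

definition reach :: "'a pair_pre_digraph \<Rightarrow> 'a \<Rightarrow> 'a set" where
  "reach H v = {u. (v, u) \<in> (parcs H)\<^sup>*}"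

definition least_reach_nbr :: "'a pair_pre_digraph \<Rightarrow> 'a \<Rightarrow> 'a" where
  "least_reach_nbr H v = arg_min (\<lambda>x. card (reach H x)) (\<lambda>x. x \<in> out_nbrs H v)"

context branching_digraph
begin

lemma least_reach_nbr_arc:
  assumes "v \<in> pverts H"
  shows "(v, least_reach_nbr H v) \<in> parcs H"
proof -
  obtain x where "x \<in> out_nbrs H v"
    using two_out_nbrs[OF assms] by (auto simp: out_nbrs_def)
  then have "least_reach_nbr H v \<in> out_nbrs H v"
    unfolding least_reach_nbr_def by (rule arg_min_natI)
  then show ?thesis
    by (simp add: out_nbrs_def)
qed

lemma least_reach_nbr_le:
  "(v, x) \<in> parcs H \<Longrightarrow> card (reach H (least_reach_nbr H v)) \<le> card (reach H x)"
  unfolding least_reach_nbr_def by (rule arg_min_nat_le) (simp add: out_nbrs_def)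

lemma finite_reach:
  assumes "v \<in> pverts H"
  shows "finite (reach H v)"
proof (rule finite_subset)
  have "u \<in> pverts H" if "(v, u) \<in> (parcs H)\<^sup>*" for u
    using that assms by (induction rule: rtrancl_induct) (auto dest: in_arcsD2)
  then show "reach H v \<subseteq> pverts H"
    by (auto simp: reach_def)
qed simp

text \<open>
  The set \<open>U\<close> here is the set of tails of the arcs that remain missing when the process stalls. A
  member \<open>u\<close> of \<open>U\<close> with the largest reach reaches any in-neighbour \<open>w\<close> of its own as well, hence lies on a
  cycle; the second out-neighbour of \<open>w\<close> is outside \<open>U\<close>, cannot return to \<open>U\<close>, and therefore has
  a strictly smaller reach than \<open>u\<close>, which contradicts the choice of \<open>u\<close> as the least-reach
  out-neighbour of \<open>w\<close>.
\<close>

lemma no_stalled_set: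
  assumes "U \<subseteq> pverts H"
    and closed: "\<And>v w. v \<in> U \<Longrightarrow> (w, v) \<in> parcs H \<Longrightarrow> w \<in> U \<and> least_reach_nbr H w = v"
  shows "U = {}"
proof (rule ccontr)
  assume "U \<noteq> {}"
  moreover have "finite U"
    using assms(1) pair_finite_verts by (rule finite_subset)
  ultimately have "Max ((\<lambda>v. card (reach H v)) ` U) \<in> (\<lambda>v. card (reach H v)) ` U"
    by (intro Max_in) auto
  then obtain u where u: "u \<in> U" and max: "card (reach H u) = Max ((\<lambda>v. card (reach H v)) ` U)"
    by force
  have largest: "card (reach H v) \<le> card (reach H u)" if "v \<in> U" for v
    unfolding max using \<open>finite U\<close> that by simp
  obtain w where wu: "(w, u) \<in> parcs H"
    using u assms(1) some_in_nbr by blast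
  then have w: "w \<in> U" and fw: "least_reach_nbr H w = u"
    using closed[OF u] by auto
  have "reach H u \<subseteq> reach H w"
    using wu by (auto simp: reach_def intro: converse_rtrancl_into_rtrancl)
  then have "reach H u = reach H w"
    using largest[OF w] w assms(1) by (intro card_seteq finite_reach) auto
  obtain x where wx: "(w, x) \<in> parcs H" and "x \<noteq> u"
    using two_out_nbrs w assms(1) by (metis subsetD)
  have "x \<notin> U"
    using closed[of x w] wx fw \<open>x \<noteq> u\<close> by blast
  have tail_in_U: "a \<in> U" if "(a, b) \<in> (parcs H)\<^sup>*" "b \<in> U" for a b
    using that by (induction rule: converse_rtrancl_induct) (use closed in blast)+
  have "u \<notin> reach H x"
    using tail_in_U u \<open>x \<notin> U\<close> by (auto simp: reach_def)
  moreover have "reach H x \<subseteq> reach H u"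
    unfolding \<open>reach H u = reach H w\<close>
    using wx by (auto simp: reach_def intro: converse_rtrancl_into_rtrancl)
  moreover have "u \<in> reach H u"
    by (simp add: reach_def)
  ultimately have "card (reach H x) < card (reach H u)"
    using u assms(1) by (intro psubset_card_mono finite_reach) auto
  then show False
    using least_reach_nbr_le[OF wx] fw by simp
qed

end

lemma ex_small_zero_forcing_set:
  assumes "branching_digraph H"
  shows "\<exists>S. zero_forcing_set (line_digraph H) S \<and>
           card S + card (pverts H) = card (pverts (line_digraph H))"
proof -
  interpret branching_digraph H by fact
  let ?V = "pverts (line_digraph H)" and ?f = "least_reach_nbr H"
  define M where "M = (\<lambda>v. Arc v (?f v)) ` pverts H"
  have "M \<subseteq> ?V"
    by (auto simp: M_def least_reach_nbr_arc)
  have fin: "finite ?V"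
    by (simp add: pverts_line_digraph_image)
  have "card M = card (pverts H)"
    unfolding M_def by (intro card_image) (auto simp: inj_on_def)
  then have card: "card (?V - M) + card (pverts H) = card ?V"
    using \<open>M \<subseteq> ?V\<close> fin by (metis card_Diff_subset card_mono finite_subset le_add_diff_inverse2)
  have "?V - M \<noteq> {}"
  proof -
    obtain v x where "v \<in> pverts H" "(v, x) \<in> parcs H" "x \<noteq> ?f v"
      using verts_nonempty two_out_nbrs by (metis ex_in_conv)
    then have "Arc v x \<in> ?V - M"
      by (auto simp: M_def)
    then show ?thesis by blast
  qed
  moreover have "\<exists>m. forced (line_digraph H) m (?V - M) = ?V"
  proof (rule forced_reaches_pverts[OF fin])
    fix T assume T: "?V - M \<subseteq> T" "T \<subset> ?V"
    show "force_step (line_digraph H) T \<noteq> T"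
    proof
      assume stalled: "force_step (line_digraph H) T = T"
      define U where "U = {v \<in> pverts H. Arc v (?f v) \<notin> T}"
      have "U = {}"
      proof (rule no_stalled_set)
        fix v w assume v: "v \<in> U" and wv: "(w, v) \<in> parcs H"
        have "v \<in> pverts H" and v_missing: "Arc v (?f v) \<notin> T"
          using v by (auto simp: U_def)
        have "Arc w v \<notin> T"
        proof
          \<comment> \<open>An arc into \<open>v\<close> would force the only arc with tail \<open>v\<close> that is missing.\<close>
          assume "Arc w v \<in> T"
          moreover have "Arc v x \<in> T" if "(v, x) \<in> parcs H" "x \<noteq> ?f v" for x
          proof -
            have "Arc v x \<in> ?V - M"
              using that by (auto simp: M_def)
            then show ?thesis using T(1) by blast
          qed
          then have "out_nbrs (line_digraph H) (Arc w v) - T = {Arc v (?f v)}"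
            using v_missing least_reach_nbr_arc[OF \<open>v \<in> pverts H\<close>]
            by (auto simp: out_nbrs_line_digraph_Arc[OF wv])
          ultimately have "Arc v (?f v) \<in> force_step (line_digraph H) T"
            using T(2) least_reach_nbr_arc[OF \<open>v \<in> pverts H\<close>]
            by (intro force_stepI[where u = "Arc w v"]) auto
          then show False
            using stalled v_missing by simp
        qed
        then have "Arc w v \<in> M"
          using T(1) wv Arc_in_line_digraph_iff[of w v H] by blast
        then show "w \<in> U \<and> ?f w = v"
          using \<open>Arc w v \<notin> T\<close> by (auto simp: M_def U_def)
      qed (auto simp: U_def)
      then have "M \<subseteq> T"
        by (auto simp: M_def U_def)
      then show False
        using T by blast
    qed
  qed auto
  ultimately have "zero_forcing_set (line_digraph H) (?V - M)"
    unfolding zero_forcing_set_def by blast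
  then show ?thesis
    using card by blast
qed

lemma zero_forcing_number_line_digraph:
  assumes "branching_digraph H"
  shows "zero_forcing_number (line_digraph H) + card (pverts H) = card (pverts (line_digraph H))"
proof -
  interpret branching_digraph H by fact
  let ?Z = "{S. zero_forcing_set (line_digraph H) S}"
  have "?Z \<subseteq> Pow (pverts (line_digraph H))"
    by (auto simp: zero_forcing_set_def)
  then have "finite ?Z"
    by (rule finite_subset) (simp add: pverts_line_digraph_image)
  obtain S where S: "zero_forcing_set (line_digraph H) S"
    and card_S: "card S + card (pverts H) = card (pverts (line_digraph H))"
    using ex_small_zero_forcing_set[OF assms] by blast
  have "card S \<le> card S'" if "zero_forcing_set (line_digraph H) S'" for S'
  proof -
    have "card (pverts (line_digraph H)) \<le> card S' + card (pverts H)"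
      using that by (intro card_zero_forcing_set_ge) (auto dest: in_arcsD1 in_arcsD2)
    then show ?thesis
      using card_S by simp
  qed
  then have "zero_forcing_number (line_digraph H) = card S"
    unfolding zero_forcing_number_def
    using \<open>finite ?Z\<close> S by (intro Min_eqI) auto
  then show ?thesis
    using card_S by simp
qed

section \<open>Iterated line digraphs\<close>

theorem theorem3p10:
  fixes G :: "'a pair_pre_digraph" and n :: nat
  assumes "pair_fin_digraph G"
    and "pverts G \<noteq> {}"
    and "connected (with_proj G)"
    and "min_out_degree G \<ge> 2"
    and "min_in_degree G \<ge> 1"
    and "n \<ge> 1"
  shows "int (zero_forcing_number (iter_line_digraph n G)) =
         int (card (pverts (iter_line_digraph n G)))
         - int (card (pverts (iter_line_digraph (n - 1) G)))"
proof -
  have "branching_digraph (iter_line_digraph (n - 1) G)"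
    using assms by (intro branching_iter_line_digraph branching_digraphI_degrees)
  moreover have "iter_line_digraph n G = line_digraph (iter_line_digraph (n - 1) G)"
    using assms(6) by (cases n) (simp_all add: iter_line_digraph_def)
  ultimately show ?thesis
    using zero_forcing_number_line_digraph by fastforce
qed

end
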